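(* Let $S^2\subset\mathbb R^3$ be the unit sphere with its standard metric and symplectic structure, and let $TS^2$ carry the Poisson structure dual to the Lie algebroid $T^*S^2$. The map $$\pi:TS^2\to S^2,\qquad (u,p)\mapsto\exp_p\Big(\frac{1}{\|u\|}\arcsin\Big(\frac{\|u\|}{2}\Big)u\Big),$$ defined on the neighbourhood $\{\|u\|<2\}$ of the zero section $S^2$ in $TS^2$ (with $\pi(0,p)=p$), is Poisson.
   Context: For $p\in S^2$ and $u\in T_pS^2$, $\exp_p(u)=\cos(\|u\|)p+\frac{\sin\|u\|}{\|u\|}u$ is the Riemannian exponential. The symplectic form is $\omega=g(J\cdot,\cdot)$ with $g$ the restriction of the euclidean metric and $J_p(u)=u\times p$; the Poisson bivector is $\eta(p)=\frac{1}{\|u\|^2}u\wedge(p\times u)$ for any $0\neq u\in T_pS^2$. For a Poisson manifold $P$ with bivector $\eta$, the Poisson structure on $TP$ (dual of the Lie algebroid $T^*P$ with anchor $\eta:T^*P\to TP$, $\beta(\eta(\alpha))=\eta(\alpha,\beta)$) is determined as follows: let $\mathrm{pr}:TP\to P$ be the projection and $\widetilde\alpha(v)=\alpha(v)$ for a 1-form $\alpha$. For closed 1-forms $\alpha,\beta$ and functions $f,g$ on $P$: $\{\widetilde\alpha,\widetilde\beta\}_{TP}(v)=[\alpha,\beta](v)$ where $[\alpha,\beta]=\mathrm d(\eta(\alpha,\beta))$; $\{\widetilde\alpha,\mathrm{pr}^*f\}_{TP}(v)=\eta(\alpha(x))\cdot f$ for $v\in T_xP$; $\{\mathrm{pr}^*f,\mathrm{pr}^*g\}_{TP}=0$.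 Poisson means $\{\pi^*f,\pi^*g\}_{TP}=\pi^*\{f,g\}_P$ with $\{f,g\}_P=\eta(\mathrm df,\mathrm dg)$. *)

theory Defs
  imports "HOL-Analysis.Analysis"
begin

subsection \<open>Smooth functions and differentials on submanifolds of a Euclidean space\<close>

primrec Ck_on :: "nat \<Rightarrow> ('a::euclidean_space \<Rightarrow> 'b::real_normed_vector) \<Rightarrow> 'a set \<Rightarrow> bool"
where
  "Ck_on 0 f U \<longleftrightarrow> continuous_on U f"
| "Ck_on (Suc k) f U \<longleftrightarrow>
     (\<forall>x\<in>U. f differentiable (at x)) \<and> (\<forall>v. Ck_on k (\<lambda>x. frechet_derivative f (at x) v) U)"

definition smooth_on_open :: "'a set \<Rightarrow> ('a::euclidean_space \<Rightarrow> 'b::real_normed_vector) \<Rightarrow> bool"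
where
  "smooth_on_open U f \<longleftrightarrow> open U \<and> (\<forall>k. Ck_on k f U)"

definition smooth_on :: "'a set \<Rightarrow> ('a::euclidean_space \<Rightarrow> 'b::real_normed_vector) \<Rightarrow> bool"
where
  "smooth_on M f \<longleftrightarrow> (\<exists>U h. M \<subseteq> U \<and> smooth_on_open U h \<and> (\<forall>x\<in>M. h x = f x))"

definition tangent_space :: "'a::euclidean_space set \<Rightarrow> 'a \<Rightarrow> 'a set"
where
  "tangent_space M x =
     {v. \<exists>\<gamma>::real \<Rightarrow> 'a. (\<forall>t. \<gamma> t \<in> M) \<and> \<gamma> 0 = x \<and> (\<gamma> has_vector_derivative v) (at 0)}"

text \<open>Following the paper, points of the tangent bundle are written \<open>(u, p)\<close> with the
  tangent vector first.\<close>

definition tangent_bundle :: "'a::euclidean_space set \<Rightarrow> ('a \<times> 'a) set"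
where
  "tangent_bundle P = {(u, p). p \<in> P \<and> u \<in> tangent_space P p}"

text \<open>A covector at \<open>x \<in> M\<close> is represented by a linear functional on the ambient space,
  of which only the restriction to \<open>tangent_space M x\<close> is meaningful.  The derivative
  below is taken within \<open>M\<close>, so it depends only on the values of \<open>f\<close> on \<open>M\<close>.  It is an
  arbitrary choice in the normal directions, but its restriction to the tangent space
  is uniquely determined.\<close>

definition differential :: "'a::euclidean_space set \<Rightarrow> ('a \<Rightarrow> real) \<Rightarrow> 'a \<Rightarrow> ('a \<Rightarrow>\<^sub>L real)"
where
  "differential M f x = Blinfun (frechet_derivative f (at x within M))"

text \<open>Every smooth closed 1-form on \<open>P\<close> is the restriction of a smooth ambient 1-form \<open>\<alpha>\<close>
  whose exterior derivative \<open>(d\<alpha>)\<^sub>x(v, w) = (D\<alpha>\<^sub>x v)(w) - (D\<alpha>\<^sub>x w)(v)\<close> vanishes on pairs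
  of vectors tangent to \<open>P\<close>.\<close>

definition closed_1form :: "'a::euclidean_space set \<Rightarrow> ('a \<Rightarrow> ('a \<Rightarrow>\<^sub>L real)) \<Rightarrow> bool"
where
  "closed_1form P \<alpha> \<longleftrightarrow>
     (\<exists>U. P \<subseteq> U \<and> smooth_on_open U \<alpha>) \<and>
     (\<forall>x\<in>P. \<forall>v\<in>tangent_space P x. \<forall>w\<in>tangent_space P x.
        blinfun_apply (frechet_derivative \<alpha> (at x) v) w =
        blinfun_apply (frechet_derivative \<alpha> (at x) w) v)"

subsection \<open>Bivectors, brackets and Poisson maps\<close>

type_synonym 'a bivector = "('a \<Rightarrow>\<^sub>L real) \<Rightarrow> ('a \<Rightarrow>\<^sub>L real) \<Rightarrow> real"

definition wedge :: "'a::euclidean_space \<Rightarrow> 'a \<Rightarrow> 'a bivector"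
where
  "wedge u v A B = A u * B v - A v * B u"

text \<open>The last conjunct makes \<open>L\<close> a form on the cotangent space of \<open>M\<close> at \<open>x\<close>,
  i.e. an element of the second exterior power of \<open>tangent_space M x\<close>.\<close>

definition bivector_at :: "'a::euclidean_space set \<Rightarrow> 'a \<Rightarrow> 'a bivector \<Rightarrow> bool"
where
  "bivector_at M x L \<longleftrightarrow>
     bilinear L \<and> (\<forall>A. L A A = 0) \<and>
     (\<forall>A B C. (\<forall>v\<in>tangent_space M x. blinfun_apply A v = blinfun_apply B v) \<longrightarrow> L A C = L B C)"

definition bracket ::
  "'a::euclidean_space set \<Rightarrow> ('a \<Rightarrow> 'a bivector) \<Rightarrow> ('a \<Rightarrow> real) \<Rightarrow> ('a \<Rightarrow> real) \<Rightarrow> 'a \<Rightarrow> real"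
where
  "bracket M \<eta> f g x = \<eta> x (differential M f x) (differential M g x)"

definition poisson_map ::
  "'a::euclidean_space set \<Rightarrow> ('a \<Rightarrow> 'a bivector) \<Rightarrow>
   'b::euclidean_space set \<Rightarrow> ('b \<Rightarrow> 'b bivector) \<Rightarrow> ('a \<Rightarrow> 'b) \<Rightarrow> bool"
where
  "poisson_map M \<Lambda> N \<eta> \<phi> \<longleftrightarrow>
     \<phi> ` M \<subseteq> N \<and> smooth_on M \<phi> \<and>
     (\<forall>f g. smooth_on N f \<longrightarrow> smooth_on N g \<longrightarrow>
        (\<forall>z\<in>M. bracket M \<Lambda> (f \<circ> \<phi>) (g \<circ> \<phi>) z = bracket N \<eta> f g (\<phi> z)))"

subsection \<open>The Poisson structure on the tangent bundle of a Poisson manifold\<close>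

definition fibre_linear :: "('a::euclidean_space \<Rightarrow> ('a \<Rightarrow>\<^sub>L real)) \<Rightarrow> 'a \<times> 'a \<Rightarrow> real"
where
  "fibre_linear \<alpha> = (\<lambda>(u, p). blinfun_apply (\<alpha> p) u)"

text \<open>The three clauses of \<open>dual_bivector_at\<close> are the relations for
  \<open>{\<alpha>\<^sup>~, \<beta>\<^sup>~}\<close>, \<open>{\<alpha>\<^sup>~, pr\<^sup>*f}\<close> and \<open>{pr\<^sup>*f, pr\<^sup>*g}\<close>, where \<open>pr = snd\<close> and
  \<open>\<alpha>\<^sup>~ = fibre_linear \<alpha>\<close>.
  By the convention \<open>\<beta>(\<eta>(\<alpha>)) = \<eta>(\<alpha>, \<beta>)\<close> for the anchor, the derivative of \<open>f\<close> along
  \<open>\<eta>(\<alpha>)\<close> is \<open>\<eta>(\<alpha>, df)\<close>.\<close>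

definition dual_bivector_at ::
  "'a::euclidean_space set \<Rightarrow> ('a \<Rightarrow> 'a bivector) \<Rightarrow> 'a \<times> 'a \<Rightarrow> ('a \<times> 'a) bivector \<Rightarrow> bool"
where
  "dual_bivector_at P \<eta> z L \<longleftrightarrow>
     bivector_at (tangent_bundle P) z L \<and>
     (\<forall>\<alpha> \<beta>. closed_1form P \<alpha> \<longrightarrow> closed_1form P \<beta> \<longrightarrow>
        bracket (tangent_bundle P) (\<lambda>_. L) (fibre_linear \<alpha>) (fibre_linear \<beta>) z =
        fibre_linear (differential P (\<lambda>x. \<eta> x (\<alpha> x) (\<beta> x))) z) \<and>
     (\<forall>\<alpha> f. closed_1form P \<alpha> \<longrightarrow> smooth_on P f \<longrightarrow>
        bracket (tangent_bundle P) (\<lambda>_. L) (fibre_linear \<alpha>) (f \<circ> snd) z =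
        \<eta> (snd z) (\<alpha> (snd z)) (differential P f (snd z))) \<and>
     (\<forall>f g. smooth_on P f \<longrightarrow> smooth_on P g \<longrightarrow>
        bracket (tangent_bundle P) (\<lambda>_. L) (f \<circ> snd) (g \<circ> snd) z = 0)"

text \<open>The relations determine the bivector at \<open>z\<close>, since the differentials of the functions
  \<open>\<alpha>\<^sup>~\<close> and \<open>pr\<^sup>*f\<close> span the cotangent space at \<open>z\<close>.\<close>

definition dual_bivector ::
  "'a::euclidean_space set \<Rightarrow> ('a \<Rightarrow> 'a bivector) \<Rightarrow> 'a \<times> 'a \<Rightarrow> ('a \<times> 'a) bivector"
where
  "dual_bivector P \<eta> z = (THE L. dual_bivector_at P \<eta> z L)"

subsection \<open>The unit sphere\<close>

definition S2 :: "(real^3) set"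
where
  "S2 = sphere 0 1"

text \<open>The value does not depend on the tangent vector \<open>u\<close>.\<close>

definition S2_bivector :: "real^3 \<Rightarrow> (real^3) bivector"
where
  "S2_bivector p A B =
     (THE c. \<forall>u\<in>tangent_space S2 p - {0}. c = 1 / (norm u)\<^sup>2 * wedge u (cross3 p u) A B)"

text \<open>For \<open>u = 0\<close> the convention \<open>x / 0 = 0\<close> gives the intended value \<open>p\<close>, both here
  and in \<open>S2_proj\<close>.\<close>

definition S2_exp :: "real^3 \<Rightarrow> real^3 \<Rightarrow> real^3"
where
  "S2_exp p u = cos (norm u) *\<^sub>R p + (sin (norm u) / norm u) *\<^sub>R u"

definition S2_proj :: "(real^3) \<times> (real^3) \<Rightarrow> real^3"
where
  "S2_proj = (\<lambda>(u, p). S2_exp p ((1 / norm u * arcsin (norm u / 2)) *\<^sub>R u))"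

lemma S2_proj_zero_section: "S2_proj (0, p) = p"
  by (simp add: S2_proj_def S2_exp_def)

end

theory Submission
  imports Defs
begin

text \<open>Write covectors as vectors of \<open>\<real>\<^sup>3\<close> through the inner product.  The bivector of the sphere is then
  \<open>p \<bullet> (a \<times> b)\<close>, the restriction of the linear Poisson structure \<open>{p\<^sub>i, p\<^sub>j} = \<epsilon>\<^sub>i\<^sub>j\<^sub>k p\<^sub>k\<close> of
  \<open>so(3)\<close> (\<open>S2_bivector_eq\<close>).  Accordingly the dual structure on the tangent bundle is the restriction
  of the linear structure on \<open>\<real>\<^sup>6\<close> with
  \<open>{u\<^sub>i, u\<^sub>j} = \<epsilon>\<^sub>i\<^sub>j\<^sub>k u\<^sub>k\<close>, \<open>{u\<^sub>i, p\<^sub>j} = \<epsilon>\<^sub>i\<^sub>j\<^sub>k p\<^sub>k\<close> and \<open>{p\<^sub>i, p\<^sub>j} = 0\<close>,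
  for which \<open>p \<bullet> p\<close> and \<open>u \<bullet> p\<close> are Casimirs.  The lemma \<open>dual_bivector_at_so3_tangent\<close> checks the
  defining relations, where closedness of the forms enters, and \<open>dual_bivector_at_S2_unique\<close> shows that
  they leave no choice.

  The arcsine in the projection cancels against the exponential, and the map becomes
  \<open>\<pi>(u, p) = s p + u/2\<close> with \<open>s = sqrt (1 - (u \<bullet> u)/4)\<close> (\<open>S2_proj_eq\<close>), which is smooth for
  \<open>norm u < 2\<close>.  In the bracket of two components of \<open>\<pi>\<close> the cross terms between \<open>s p\<close> and
  \<open>u/2\<close> contribute \<open>s p\<close>, the term quadratic in \<open>u/2\<close> contributes \<open>u/4\<close>, and the brackets of \<open>s\<close>
  with \<open>p\<close> contribute another \<open>u/4\<close>: since \<open>p\<close> is a unit vector orthogonal to \<open>u\<close>, the triple product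
  \<open>u \<bullet> (a \<times> b)\<close> involves only the terms in which one of \<open>a\<close>, \<open>b\<close> is replaced by its component
  along \<open>p\<close> (\<open>triple_product_exchange\<close>).  The total is \<open>\<pi>\<close> again.\<close>

section \<open>Calculus of smooth maps\<close>

lemma Ck_on_cong:
  assumes "open U" "\<And>x. x \<in> U \<Longrightarrow> f x = g x"
  shows "Ck_on k f U \<longleftrightarrow> Ck_on k g U"
  using assms(2)
proof (induction k arbitrary: f g)
  case 0
  then show ?case by (simp cong: continuous_on_cong)
next
  case (Suc k)
  have imp: "Ck_on (Suc k) g U"
    if f: "Ck_on (Suc k) f U" and eq: "\<And>x. x \<in> U \<Longrightarrow> f x = g x"
    for f g :: "'a \<Rightarrow> 'b"
  proof -
    have "g differentiable (at x)" if "x \<in> U" for x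
    proof -
      have "(f has_derivative frechet_derivative f (at x)) (at x)"
        using f that by (simp flip: frechet_derivative_works)
      then have "(g has_derivative frechet_derivative f (at x)) (at x)"
        by (rule has_derivative_transform_within_open[OF _ \<open>open U\<close> that]) (rule eq)
      then show ?thesis by (auto simp: differentiable_def)
    qed
    moreover have "frechet_derivative f (at x) = frechet_derivative g (at x)" if "x \<in> U" for x
      using f that
      by (intro frechet_derivative_transform_within_open[OF _ \<open>open U\<close> that eq]) auto
    then have "Ck_on k (\<lambda>x. frechet_derivative f (at x) v) U
        \<longleftrightarrow> Ck_on k (\<lambda>x. frechet_derivative g (at x) v) U" for v
      by (intro Suc.IH) simp
    ultimately show ?thesis using f by simp
  qed
  have "\<And>x. x \<in> U \<Longrightarrow> g x = f x" by (rule Suc.prems[symmetric])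
  then show ?case using imp[of f g] imp[of g f] Suc.prems by blast
qed

lemma Ck_on_SucI:
  assumes "open U" "\<And>x. x \<in> U \<Longrightarrow> (f has_derivative f' x) (at x)"
    "\<And>v. Ck_on k (\<lambda>x. f' x v) U"
  shows "Ck_on (Suc k) f U"
proof -
  have "f' x v = frechet_derivative f (at x) v" if "x \<in> U" for x v
    using assms(2)[OF that] by (simp add: frechet_derivative_at[symmetric])
  then have "Ck_on k (\<lambda>x. f' x v) U \<longleftrightarrow> Ck_on k (\<lambda>x. frechet_derivative f (at x) v) U" for v
    using \<open>open U\<close> by (intro Ck_on_cong) auto
  then show ?thesis using assms by (auto simp: differentiable_def)
qed

lemma Ck_on_Suc_has_derivative:
  assumes "Ck_on (Suc k) f U" "x \<in> U"
  shows "(f has_derivative frechet_derivative f (at x)) (at x)"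
  using assms by (simp flip: frechet_derivative_works)

lemma Ck_on_SucD: "Ck_on (Suc k) f U \<Longrightarrow> Ck_on k f U"
proof (induction k arbitrary: f)
  case 0
  have "continuous (at x) f" if "x \<in> U" for x
    by (rule differentiable_imp_continuous_within) (use 0 that in simp)
  then show ?case by (simp add: continuous_at_imp_continuous_on)
next
  case (Suc k)
  have "Ck_on k (\<lambda>x. frechet_derivative f (at x) v) U" for v
    by (rule Suc.IH) (rule Suc.prems[unfolded Ck_on.simps(2)[of "Suc k"], THEN conjunct2, THEN spec])
  then show ?case using Suc.prems by simp
qed

lemma Ck_on_const: "open U \<Longrightarrow> Ck_on k (\<lambda>x. c) U"
proof (induction k arbitrary: c)
  case (Suc k)
  then show ?case by (intro Ck_on_SucI[where f' = "\<lambda>x v. 0"]) auto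
qed simp

lemma Ck_on_bounded_linear:
  assumes "open U" "bounded_linear f"
  shows "Ck_on k f U"
proof (cases k)
  case 0
  then show ?thesis using assms by (simp add: linear_continuous_on)
next
  case (Suc m)
  show ?thesis unfolding Suc
    using assms by (intro Ck_on_SucI) (auto intro: bounded_linear_imp_has_derivative Ck_on_const)
qed

lemma Ck_on_add:
  assumes "open U" "Ck_on k f U" "Ck_on k g U"
  shows "Ck_on k (\<lambda>x. f x + g x) U"
  using assms(2,3)
proof (induction k arbitrary: f g)
  case 0
  then show ?case by (simp add: continuous_on_add)
next
  case (Suc k)
  let ?f = "\<lambda>x. frechet_derivative f (at x)" and ?g = "\<lambda>x. frechet_derivative g (at x)"
  show ?case
  proof (rule Ck_on_SucI[OF \<open>open U\<close>])
    show "((\<lambda>x. f x + g x) has_derivative (\<lambda>h. ?f x h + ?g x h)) (at x)" if "x \<in> U" for x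
      using that Suc.prems by (intro has_derivative_add Ck_on_Suc_has_derivative)
    show "Ck_on k (\<lambda>x. ?f x v + ?g x v) U" for v
      using Suc.prems by (intro Suc.IH) auto
  qed
qed

lemma Ck_on_bounded_bilinear:
  assumes "open U" "bounded_bilinear B" "Ck_on k f U" "Ck_on k g U"
  shows "Ck_on k (\<lambda>x. B (f x) (g x)) U"
  using assms(3,4)
proof (induction k arbitrary: f g)
  case 0
  then show ?case using bounded_bilinear.continuous_on[OF assms(2)] by simp
next
  case (Suc k)
  let ?f = "\<lambda>x. frechet_derivative f (at x)" and ?g = "\<lambda>x. frechet_derivative g (at x)"
  show ?case
  proof (rule Ck_on_SucI[OF \<open>open U\<close>])
    show "((\<lambda>x. B (f x) (g x)) has_derivative (\<lambda>h. B (f x) (?g x h) + B (?f x h) (g x))) (at x)"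
      if "x \<in> U" for x
      using that Suc.prems
      by (intro bounded_bilinear.FDERIV[OF assms(2)] Ck_on_Suc_has_derivative)
    show "Ck_on k (\<lambda>x. B (f x) (?g x v) + B (?f x v) (g x)) U" for v
      using Suc.prems Suc.prems[THEN Ck_on_SucD] by (intro Ck_on_add Suc.IH \<open>open U\<close>) simp_all
  qed
qed

text \<open>All real exponents are treated at once, because differentiation lowers the exponent:
  the statement for square roots alone would not carry an induction.\<close>

lemma Ck_on_powr:
  fixes f :: "'a::euclidean_space \<Rightarrow> real"
  assumes "open U" "Ck_on k f U" "\<And>x. x \<in> U \<Longrightarrow> f x > 0"
  shows "Ck_on k (\<lambda>x. f x powr a) U"
  using assms(2)
proof (induction k arbitrary: a)
  case 0
  then show ?case using assms(3) by (simp add: continuous_on_powr order_less_imp_not_eq2)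
next
  case (Suc k)
  let ?f = "\<lambda>x. frechet_derivative f (at x)"
  show ?case
  proof (rule Ck_on_SucI[OF \<open>open U\<close>])
    fix x assume x: "x \<in> U"
    show "((\<lambda>x. f x powr a) has_derivative (\<lambda>h. a * (f x powr (a - 1) * ?f x h))) (at x)"
      using Ck_on_Suc_has_derivative[OF Suc.prems x] assms(3)[OF x]
      by (auto intro!: derivative_eq_intros simp: powr_diff fun_eq_iff)
  next
    fix v
    have "Ck_on k (\<lambda>x. f x powr (a - 1)) U"
      by (rule Suc.IH) (rule Ck_on_SucD[OF Suc.prems])
    moreover have "Ck_on k (\<lambda>x. ?f x v) U" using Suc.prems by simp
    ultimately show "Ck_on k (\<lambda>x. a * (f x powr (a - 1) * ?f x v)) U"
      by (intro Ck_on_bounded_bilinear[OF \<open>open U\<close> bounded_bilinear_mult] Ck_on_const \<open>open U\<close>)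
  qed
qed

lemma smooth_on_bounded_linear: "bounded_linear f \<Longrightarrow> smooth_on M f"
  unfolding smooth_on_def smooth_on_open_def
  by (intro exI[of _ UNIV] exI[of _ f]) (auto intro: Ck_on_bounded_linear)

lemma smooth_on_open_has_derivative:
  assumes "smooth_on_open U f" "x \<in> U"
  shows "(f has_derivative frechet_derivative f (at x)) (at x)"
  using assms Ck_on_Suc_has_derivative[of 0] unfolding smooth_on_open_def by blast

section \<open>Differentials on submanifolds\<close>

text \<open>The gradient vector that represents a covector.\<close>

definition sharp :: "('a::euclidean_space \<Rightarrow>\<^sub>L real) \<Rightarrow> 'a"
  where "sharp A = (\<Sum>b\<in>Basis. A b *\<^sub>R b)"

lemma inner_sharp: "sharp A \<bullet> v = blinfun_apply A v"
proof -
  have "blinfun_apply A v = A (\<Sum>b\<in>Basis. (v \<bullet> b) *\<^sub>R b)"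
    by (simp add: euclidean_representation)
  also have "\<dots> = sharp A \<bullet> v"
    unfolding sharp_def blinfun.sum_right
    by (simp add: inner_sum_left blinfun.scaleR_right inner_commute[of v] mult.commute)
  finally show ?thesis by simp
qed

lemma sharp_eqI: "(\<And>v. blinfun_apply A v = a \<bullet> v) \<Longrightarrow> sharp A = a"
  by (metis inner_sharp vector_eq_rdot)

lemma bounded_linear_sharp: "bounded_linear sharp"
  unfolding sharp_def[abs_def]
  by (intro bounded_linear_sum bounded_linear_scaleR_left[THEN bounded_linear_compose]
      blinfun.bounded_linear_left)

lemma sharp_inner_right [simp]: "sharp (blinfun_inner_right a) = a"
  by (rule sharp_eqI) simp

lemmas sharp_add = linear_add[OF bounded_linear.linear[OF bounded_linear_sharp]]
  and sharp_scaleR = linear_scale[OF bounded_linear.linear[OF bounded_linear_sharp]]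

text \<open>The within-derivative is determined on vectors tangent to curves in \<open>M\<close>, because along such
  a curve it computes an ordinary derivative in one variable.\<close>

lemma derivative_within_unique_on_tangent_space:
  assumes "(f has_derivative D) (at x within M)" "(f has_derivative D') (at x within M)"
    and "v \<in> tangent_space M x"
  shows "D v = D' v"
proof -
  obtain \<gamma> where \<gamma>: "\<And>t. \<gamma> t \<in> M" "\<gamma> 0 = x" "(\<gamma> has_vector_derivative v) (at (0::real))"
    using assms(3) unfolding tangent_space_def by auto
  have along: "(f \<circ> \<gamma> has_vector_derivative E v) (at 0)"
    if "(f has_derivative E) (at x within M)" for E
  proof -
    have "(f has_derivative E) (at (\<gamma> 0) within range \<gamma>)"
      using that \<gamma> by (auto intro: has_derivative_subset)
    then have "(f \<circ> \<gamma> has_derivative E \<circ> (\<lambda>t. t *\<^sub>R v)) (at 0)"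
      using \<gamma>(3) unfolding has_vector_derivative_def by (intro diff_chain_within) auto
    moreover have "E (t *\<^sub>R v) = t *\<^sub>R E v" for t
      using that has_derivative_linear linear_scale by blast
    ultimately show ?thesis by (simp add: has_vector_derivative_def comp_def)
  qed
  show ?thesis using vector_derivative_unique_at along assms(1,2) by blast
qed

lemma differential_tangent:
  assumes "(f has_derivative D) (at x within M)" "v \<in> tangent_space M x"
  shows "blinfun_apply (differential M f x) v = D v"
proof -
  have D: "(f has_derivative frechet_derivative f (at x within M)) (at x within M)"
    using assms(1) frechet_derivative_works differentiable_def by blast
  then have "bounded_linear (frechet_derivative f (at x within M))"
    by (rule has_derivative_bounded_linear)
  then show ?thesis
    unfolding differential_def
    using derivative_within_unique_on_tangent_space[OF D assms] by (simp add: bounded_linear_Blinfun_apply)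
qed

lemma smooth_on_has_derivative:
  fixes f :: "'a::euclidean_space \<Rightarrow> real"
  assumes "smooth_on M f" "x \<in> M"
  obtains h a where "(h has_derivative (\<lambda>v. a \<bullet> v)) (at x)" "\<And>y. y \<in> M \<Longrightarrow> h y = f y"
proof -
  obtain U h where h: "M \<subseteq> U" "smooth_on_open U h" "\<And>y. y \<in> M \<Longrightarrow> h y = f y"
    using assms unfolding smooth_on_def by auto
  then have D: "(h has_derivative frechet_derivative h (at x)) (at x)"
    using smooth_on_open_has_derivative assms by blast
  define a where "a = sharp (Blinfun (frechet_derivative h (at x)))"
  have "a \<bullet> v = frechet_derivative h (at x) v" for v
    unfolding a_def inner_sharp
    using has_derivative_bounded_linear[OF D] by (simp add: bounded_linear_Blinfun_apply)
  then have "(h has_derivative (\<lambda>v. a \<bullet> v)) (at x)" using D by presburger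
  with h(3) that show ?thesis by blast
qed

text \<open>A form on the cotangent space sees only tangential parts, so in a bracket the differentials
  can be replaced by any choice of derivatives within \<open>M\<close>.\<close>

lemma bracket_eq:
  assumes "bivector_at M x (\<eta> x)"
    and "(f has_derivative blinfun_apply A) (at x within M)"
    and "(g has_derivative blinfun_apply B) (at x within M)"
  shows "bracket M \<eta> f g x = \<eta> x A B"
proof -
  let ?L = "\<eta> x"
  have L: "bilinear ?L" "\<And>A. ?L A A = 0" 
    and cong: "\<And>A B C. (\<And>v. v \<in> tangent_space M x \<Longrightarrow> blinfun_apply A v = blinfun_apply B v)
      \<Longrightarrow> ?L A C = ?L B C"
    using assms(1) unfolding bivector_at_def by blast+
  have anti: "?L X Y = - ?L Y X" for X Y
    using L(2)[of "X + Y"] L(2)[of X] L(2)[of Y]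
    by (simp add: bilinear_ladd[OF L(1)] bilinear_radd[OF L(1)])
  have "?L (differential M f x) (differential M g x) = ?L A (differential M g x)"
    using assms(2) by (intro cong differential_tangent)
  also have "\<dots> = - ?L B A"
    using assms(3) by (subst anti) (intro arg_cong[of _ _ uminus] cong differential_tangent)
  finally show ?thesis unfolding bracket_def using anti[of A B] by simp
qed

section \<open>The Poisson structure of the sphere\<close>

lemma S2_iff: "p \<in> S2 \<longleftrightarrow> p \<bullet> p = 1"
  by (simp add: S2_def norm_eq_1)

lemma normal_if_orthogonal_to_tangent:
  fixes p a :: "'a::real_inner"
  assumes "p \<bullet> p = 1" "\<And>v. p \<bullet> v = 0 \<Longrightarrow> a \<bullet> v = 0"
  shows "a = (a \<bullet> p) *\<^sub>R p"
proof -
  define v where "v = a - (a \<bullet> p) *\<^sub>R p"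
  have "p \<bullet> v = 0" by (simp add: v_def assms(1) algebra_simps inner_commute)
  moreover from this have "a \<bullet> v = 0" by (rule assms(2))
  ultimately have "v \<bullet> v = 0"
    using inner_diff_left[of a "(a \<bullet> p) *\<^sub>R p" v] by (simp flip: v_def)
  then show ?thesis by (simp add: v_def)
qed

text \<open>A multiple of \<open>p\<close> added to a factor does not change \<open>p \<bullet> (a \<times> c)\<close>; this is why that expression
  is a form on the cotangent space of the sphere.\<close>

lemma triple_product_tangential:
  assumes "p \<bullet> p = 1" "\<And>v. p \<bullet> v = 0 \<Longrightarrow> a \<bullet> v = b \<bullet> v"
  shows "p \<bullet> cross3 a c = p \<bullet> cross3 b c"
proof -
  have "a - b = ((a - b) \<bullet> p) *\<^sub>R p"
    using assms by (intro normal_if_orthogonal_to_tangent) (auto simp: inner_diff_left)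
  then obtain k where "a = b + k *\<^sub>R p" by (metis add.commute diff_add_cancel)
  then show ?thesis
    by (simp add: cross_add_left cross_mult_left inner_add_right dot_cross_self)
qed

lemma tangent_space_S2:
  assumes "p \<in> S2"
  shows "tangent_space S2 p = {v. p \<bullet> v = 0}"
proof (intro equalityI subsetI)
  fix v assume "v \<in> tangent_space S2 p"
  then obtain \<gamma> where \<gamma>: "\<And>t. \<gamma> t \<in> S2" "\<gamma> 0 = p" "(\<gamma> has_vector_derivative v) (at (0::real))"
    unfolding tangent_space_def by auto
  have "((\<lambda>t. \<gamma> t \<bullet> \<gamma> t) has_vector_derivative (p \<bullet> v + v \<bullet> p)) (at 0)"
    using bounded_bilinear.has_vector_derivative[OF bounded_bilinear_inner \<gamma>(3) \<gamma>(3)] \<gamma>(2) by simp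
  moreover have "((\<lambda>t. \<gamma> t \<bullet> \<gamma> t) has_vector_derivative 0) (at 0)"
    using \<gamma>(1) by (simp add: S2_iff)
  ultimately have "p \<bullet> v + v \<bullet> p = 0" using vector_derivative_unique_at by blast
  then show "v \<in> {v. p \<bullet> v = 0}" by (simp add: inner_commute)
next
  fix v assume "v \<in> {v. p \<bullet> v = 0}"
  then have pv: "p \<bullet> v = 0" by simp
  \<comment> \<open>The line with direction \<open>v\<close>, pushed radially onto the sphere.\<close>
  define \<gamma> where "\<gamma> t = (1 / sqrt (1 + t\<^sup>2 * (v \<bullet> v))) *\<^sub>R (p + t *\<^sub>R v)" for t
  have pos: "1 + t\<^sup>2 * (v \<bullet> v) > 0" for t
    by (simp add: add_pos_nonneg)
  have "\<gamma> t \<bullet> \<gamma> t = 1" for t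
  proof -
    have "(p + t *\<^sub>R v) \<bullet> (p + t *\<^sub>R v) = 1 + t\<^sup>2 * (v \<bullet> v)"
      using assms pv by (simp add: S2_iff inner_add_left inner_add_right inner_commute power2_eq_square)
    then show ?thesis using pos[of t] by (simp add: \<gamma>_def)
  qed
  moreover have "(\<gamma> has_vector_derivative v) (at 0)"
    unfolding \<gamma>_def by (auto intro!: derivative_eq_intros)
  moreover have "\<gamma> 0 = p" by (simp add: \<gamma>_def)
  ultimately show "v \<in> tangent_space S2 p"
    unfolding tangent_space_def by (auto simp: S2_iff)
qed

text \<open>For tangent \<open>u\<close> the Binet--Cauchy identity evaluates the wedge as
  \<open>(a \<times> b) \<bullet> (u \<times> (p \<times> u))\<close>, and \<open>u \<times> (p \<times> u) = (u \<bullet> u) p\<close>.\<close>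

lemma S2_bivector_eq:
  assumes "p \<in> S2"
  shows "S2_bivector p A B = p \<bullet> cross3 (sharp A) (sharp B)"
proof -
  define a b where "a = sharp A" and "b = sharp B"
  have val: "1 / (norm u)\<^sup>2 * wedge u (cross3 p u) A B = p \<bullet> cross3 a b"
    if "p \<bullet> u = 0" "u \<noteq> 0" for u
  proof -
    have "wedge u (cross3 p u) A B
        = (u \<bullet> u) * (p \<bullet> cross3 a b) - (p \<bullet> u) * (u \<bullet> cross3 a b)"
      unfolding wedge_def inner_sharp[symmetric] a_def[symmetric] b_def[symmetric]
      by (simp add: cross3_simps)
    then show ?thesis using that by (simp add: power2_norm_eq_inner)
  qed
  obtain u where "u \<noteq> 0" "orthogonal p u"
    using orthogonal_to_vector_exists[of p] by auto
  then have u: "u \<in> tangent_space S2 p - {0}"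
    using assms by (simp add: tangent_space_S2 orthogonal_def)
  show ?thesis
    unfolding S2_bivector_def a_def[symmetric] b_def[symmetric]
  proof (rule the_equality)
    show "\<forall>u\<in>tangent_space S2 p - {0}.
        p \<bullet> cross3 a b = 1 / (norm u)\<^sup>2 * wedge u (cross3 p u) A B"
      using assms val by (simp add: tangent_space_S2)
    fix c assume "\<forall>u\<in>tangent_space S2 p - {0}. c = 1 / (norm u)\<^sup>2 * wedge u (cross3 p u) A B"
    then have "c = 1 / (norm u)\<^sup>2 * wedge u (cross3 p u) A B" using u by blast
    then show "c = p \<bullet> cross3 a b" using u assms val by (simp add: tangent_space_S2)
  qed
qed

lemma bivector_at_S2:
  assumes "p \<in> S2"
  shows "bivector_at S2 p (S2_bivector p)"
  unfolding bivector_at_def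
proof (intro conjI allI impI)
  show "bilinear (S2_bivector p)"
    using assms unfolding bilinear_def linear_iff
    by (simp add: S2_bivector_eq sharp_add sharp_scaleR cross_add_left cross_add_right
        cross_mult_left cross_mult_right inner_add_right)
  show "S2_bivector p A A = 0" for A
    using assms by (simp add: S2_bivector_eq)
  show "S2_bivector p A C = S2_bivector p B C"
    if "\<forall>v\<in>tangent_space S2 p. blinfun_apply A v = blinfun_apply B v" for A B C
    using that assms unfolding S2_bivector_eq[OF assms]
    by (intro triple_product_tangential) (auto simp: S2_iff inner_sharp tangent_space_S2)
qed

lemma bracket_S2:
  assumes "p \<in> S2"
    and "(f has_derivative (\<lambda>v. a \<bullet> v)) (at p within S2)"
    and "(g has_derivative (\<lambda>v. b \<bullet> v)) (at p within S2)"
  shows "bracket S2 S2_bivector f g p = p \<bullet> cross3 a b"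
  using assms bracket_eq[where A = "blinfun_inner_right a" and B = "blinfun_inner_right b"]
  by (simp add: bivector_at_S2 S2_bivector_eq)

lemma S2_bivector_differential:
  assumes "p \<in> S2" "(f has_derivative (\<lambda>v. b \<bullet> v)) (at p within S2)"
  shows "S2_bivector p A (differential S2 f p) = p \<bullet> cross3 (sharp A) b"
proof -
  have "p \<bullet> cross3 (sharp (differential S2 f p)) (sharp A) = p \<bullet> cross3 b (sharp A)"
    using assms differential_tangent[OF assms(2)]
    by (intro triple_product_tangential) (auto simp: S2_iff inner_sharp tangent_space_S2)
  then show ?thesis
    unfolding S2_bivector_eq[OF assms(1)] by (metis cross_skew inner_minus_right)
qed

section \<open>The dual Poisson structure on the tangent bundle of the sphere\<close>

text \<open>The linear Poisson structure of the semidirect product of \<open>so(3)\<close> with its own vector space: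
  the tangent bundle of the Lie--Poisson structure \<open>p \<bullet> (a \<times> b)\<close>, first factor the fibre.\<close>

definition so3_tangent_bivector :: "(real^3) \<times> (real^3) \<Rightarrow> ((real^3) \<times> (real^3)) bivector"
  where "so3_tangent_bivector z A B =
    fst z \<bullet> cross3 (fst (sharp A)) (fst (sharp B)) +
    snd z \<bullet> cross3 (fst (sharp A)) (snd (sharp B)) +
    snd z \<bullet> cross3 (snd (sharp A)) (fst (sharp B))"

lemma tangent_bundle_S2: "(u, p) \<in> tangent_bundle S2 \<longleftrightarrow> p \<bullet> p = 1 \<and> p \<bullet> u = 0"
  by (auto simp: tangent_bundle_def S2_iff tangent_space_S2)

lemma vertical_tangent:
  assumes "(u, p) \<in> tangent_bundle S2" "p \<bullet> w = 0"
  shows "(w, 0) \<in> tangent_space (tangent_bundle S2) (u, p)"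
proof -
  have "((\<lambda>t. (u + t *\<^sub>R w, p)) has_vector_derivative (w, 0)) (at 0)"
    by (auto intro!: derivative_eq_intros has_vector_derivative_Pair)
  then show ?thesis
    using assms unfolding tangent_space_def
    by (auto simp: tangent_bundle_S2 inner_add_right intro!: exI[of _ "\<lambda>t. (u + t *\<^sub>R w, p)"])
qed

lemma horizontal_tangent:
  assumes "(u, p) \<in> tangent_bundle S2" "p \<bullet> v = 0"
  shows "(- (u \<bullet> v) *\<^sub>R p, v) \<in> tangent_space (tangent_bundle S2) (u, p)"
proof -
  have p: "p \<bullet> p = 1" "p \<bullet> u = 0" using assms(1) by (auto simp: tangent_bundle_S2)
  then have "v \<in> tangent_space S2 p" using assms(2) by (simp add: tangent_space_S2 S2_iff)
  then obtain c where c: "\<And>t. c t \<in> S2" "c 0 = p" "(c has_vector_derivative v) (at (0::real))"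
    unfolding tangent_space_def by auto
  \<comment> \<open>Lift the curve by projecting the fixed vector \<open>u\<close> to the moving tangent plane.\<close>
  define \<gamma> where "\<gamma> t = (u - (u \<bullet> c t) *\<^sub>R c t, c t)" for t
  have "((\<lambda>t. u \<bullet> c t) has_real_derivative u \<bullet> v) (at 0)"
    using bounded_linear.has_vector_derivative[OF bounded_linear_inner_right c(3)]
    by (simp add: has_real_derivative_iff_has_vector_derivative)
  then have "(\<gamma> has_vector_derivative (- (u \<bullet> v) *\<^sub>R p, v)) (at 0)"
    unfolding \<gamma>_def using p c(2)
    by (auto intro!: derivative_eq_intros has_vector_derivative_Pair c(3)
        simp: inner_commute)
  moreover have "\<gamma> t \<in> tangent_bundle S2" for t
    using c(1)[of t] by (simp add: \<gamma>_def tangent_bundle_S2 S2_iff inner_diff_right inner_commute)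
  moreover have "\<gamma> 0 = (u, p)" using p by (simp add: \<gamma>_def c(2) inner_commute)
  ultimately show ?thesis unfolding tangent_space_def by blast
qed

text \<open>Descent to the tangent bundle: the conormal space at \<open>(u, p)\<close> is spanned by the gradients
  \<open>(0, p)\<close> and \<open>(p, u)\<close> of \<open>p \<bullet> p / 2\<close> and \<open>u \<bullet> p\<close>, and both functions are Casimirs.\<close>

lemma so3_tangent_bivector_conormal:
  assumes z: "(u, p) \<in> tangent_bundle S2"
    and "\<And>v. v \<in> tangent_space (tangent_bundle S2) (u, p) \<Longrightarrow> blinfun_apply A v = 0"
  shows "so3_tangent_bivector (u, p) A C = 0"
proof -
  have p: "p \<bullet> p = 1" "p \<bullet> u = 0" using z by (auto simp: tangent_bundle_S2)
  obtain a1 a2 where a: "sharp A = (a1, a2)" by fastforce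
  then have ann: "a1 \<bullet> w + a2 \<bullet> v = 0"
    if "(w, v) \<in> tangent_space (tangent_bundle S2) (u, p)" for w v
    using assms(2)[OF that] inner_sharp[of A "(w, v)"] by simp
  define k where "k = a1 \<bullet> p"
  have a1: "a1 = k *\<^sub>R p"
    unfolding k_def using ann[OF vertical_tangent[OF z]] p
    by (intro normal_if_orthogonal_to_tangent) auto
  define l where "l = (a2 - k *\<^sub>R u) \<bullet> p"
  have "a2 - k *\<^sub>R u = l *\<^sub>R p"
    unfolding l_def using ann[OF horizontal_tangent[OF z]] p
    by (intro normal_if_orthogonal_to_tangent) (auto simp: k_def inner_diff_left)
  then have a2: "a2 = k *\<^sub>R u + l *\<^sub>R p" by (simp add: algebra_simps)
  show ?thesis
    unfolding so3_tangent_bivector_def a a1 a2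
    by (simp add: cross_add_left cross_mult_left inner_add_right dot_cross_self)
      (simp add: cross3_simps)
qed

lemma bivector_at_so3_tangent:
  assumes "z \<in> tangent_bundle S2"
  shows "bivector_at (tangent_bundle S2) z (so3_tangent_bivector z)"
  unfolding bivector_at_def
proof (intro conjI allI impI)
  show bil: "bilinear (so3_tangent_bivector z)"
    unfolding bilinear_def linear_iff so3_tangent_bivector_def
    by (simp add: sharp_add sharp_scaleR cross_add_left cross_add_right
        cross_mult_left cross_mult_right inner_add_right algebra_simps)
  show "so3_tangent_bivector z A A = 0" for A
    by (simp add: so3_tangent_bivector_def)
      (metis add.right_inverse cross_skew inner_minus_right)
  show "so3_tangent_bivector z A C = so3_tangent_bivector z B C"
    if "\<forall>v\<in>tangent_space (tangent_bundle S2) z. blinfun_apply A v = blinfun_apply B v" for A B C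
  proof -
    obtain u p where z: "z = (u, p)" by fastforce
    have "so3_tangent_bivector z (A - B) C = 0"
      using assms that unfolding z
      by (intro so3_tangent_bivector_conormal) (auto simp: blinfun.diff_left)
    then show ?thesis using bilinear_lsub[OF bil] by simp
  qed
qed

lemma bracket_so3_tangent:
  assumes "(u, p) \<in> tangent_bundle S2"
    and "(f has_derivative (\<lambda>h. (a1, a2) \<bullet> h)) (at (u, p) within tangent_bundle S2)"
    and "(g has_derivative (\<lambda>h. (b1, b2) \<bullet> h)) (at (u, p) within tangent_bundle S2)"
  shows "bracket (tangent_bundle S2) (\<lambda>_. so3_tangent_bivector (u, p)) f g (u, p) =
    u \<bullet> cross3 a1 b1 + p \<bullet> cross3 a1 b2 + p \<bullet> cross3 a2 b1"
  using assms bracket_eq[where A = "blinfun_inner_right (a1, a2)" and B = "blinfun_inner_right (b1, b2)"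
      and \<eta> = "\<lambda>_. so3_tangent_bivector (u, p)"]
  by (simp add: bivector_at_so3_tangent so3_tangent_bivector_def)

text \<open>The function \<open>\<alpha>(p)(u)\<close> has gradient \<open>\<alpha>(p)\<close> in the fibre; its gradient \<open>a\<close> in the base
  records how \<open>\<alpha>\<close> varies while \<open>u\<close> is kept fixed as an ambient vector.\<close>

lemma fibre_linear_has_derivative:
  assumes "(\<alpha> has_derivative \<alpha>') (at p)"
  obtains a where "(fibre_linear \<alpha> has_derivative (\<lambda>h. (sharp (\<alpha> p), a) \<bullet> h)) (at (u, p))"
    and "\<And>v. a \<bullet> v = blinfun_apply (\<alpha>' v) u"
proof -
  have lin: "bounded_linear \<alpha>'" using assms by (rule has_derivative_bounded_linear)
  define a where "a = sharp (Blinfun (\<lambda>v. blinfun_apply (\<alpha>' v) u))"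
  have "bounded_linear (\<lambda>v. blinfun_apply (\<alpha>' v) u)"
    by (rule bounded_linear_compose[OF blinfun.bounded_linear_left lin])
  then have a: "a \<bullet> v = blinfun_apply (\<alpha>' v) u" for v
    by (simp add: a_def inner_sharp bounded_linear_Blinfun_apply)
  have "((\<lambda>z. \<alpha> (snd z)) has_derivative (\<lambda>h. \<alpha>' (snd h))) (at (u, p))"
    by (rule has_derivative_compose[where g = \<alpha>])
      (use assms in \<open>auto intro: bounded_linear_imp_has_derivative bounded_linear_snd\<close>)
  moreover have "(fst has_derivative fst) (at (u, p))"
    by (intro bounded_linear_imp_has_derivative bounded_linear_fst)
  ultimately have "((\<lambda>z. blinfun_apply (\<alpha> (snd z)) (fst z)) has_derivative
      (\<lambda>h. blinfun_apply (\<alpha> (snd (u, p))) (fst h) + blinfun_apply (\<alpha>' (snd h)) (fst (u, p)))) (at (u, p))"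
    by (rule bounded_bilinear.FDERIV[OF bounded_bilinear_blinfun_apply])
  moreover have "fibre_linear \<alpha> = (\<lambda>z. blinfun_apply (\<alpha> (snd z)) (fst z))"
    by (auto simp: fibre_linear_def)
  ultimately have "(fibre_linear \<alpha> has_derivative (\<lambda>h. (sharp (\<alpha> p), a) \<bullet> h)) (at (u, p))"
    by (simp add: inner_prod_def a inner_sharp)
  then show ?thesis using a that by blast
qed

lemma pullback_snd_has_derivative:
  assumes "(h has_derivative (\<lambda>v. a \<bullet> v)) (at p)" "\<And>y. y \<in> P \<Longrightarrow> h y = f y"
    and z: "(u, p) \<in> tangent_bundle P"
  shows "(f \<circ> snd has_derivative (\<lambda>v. (0, a) \<bullet> v)) (at (u, p) within tangent_bundle P)"
proof (rule has_derivative_transform[OF z])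
  show "(f \<circ> snd) y = (h \<circ> snd) y" if "y \<in> tangent_bundle P" for y
    using that assms(2) by (auto simp: tangent_bundle_def)
  have "(h \<circ> snd has_derivative (\<lambda>v. a \<bullet> snd v)) (at (u, p))"
    unfolding comp_def
    by (rule has_derivative_compose[where g = h])
      (use assms in \<open>auto intro: bounded_linear_imp_has_derivative bounded_linear_snd\<close>)
  then show "(h \<circ> snd has_derivative (\<lambda>v. (0, a) \<bullet> v)) (at (u, p) within tangent_bundle P)"
    by (simp add: inner_prod_def has_derivative_at_withinI)
qed

lemma differential_S2_bivector:
  assumes "(u, p) \<in> tangent_bundle S2"
    and \<alpha>: "(\<alpha> has_derivative \<alpha>') (at p)" and \<beta>: "(\<beta> has_derivative \<beta>') (at p)"
  shows "blinfun_apply (differential S2 (\<lambda>x. S2_bivector x (\<alpha> x) (\<beta> x)) p) u =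
    u \<bullet> cross3 (sharp (\<alpha> p)) (sharp (\<beta> p)) +
    p \<bullet> cross3 (sharp (\<alpha>' u)) (sharp (\<beta> p)) + p \<bullet> cross3 (sharp (\<alpha> p)) (sharp (\<beta>' u))"
    (is "_ = ?D u")
proof (rule differential_tangent)
  show "u \<in> tangent_space S2 p" using assms(1) by (simp add: tangent_bundle_def)
  have cross: "bounded_bilinear cross3"
    using bilinear_cross by (simp add: bilinear_conv_bounded_bilinear)
  note sh = bounded_linear.has_derivative[OF bounded_linear_sharp]
  have "((\<lambda>x. x \<bullet> cross3 (sharp (\<alpha> x)) (sharp (\<beta> x))) has_derivative ?D) (at p)"
    by (rule has_derivative_eq_rhs[OF bounded_bilinear.FDERIV[OF bounded_bilinear_inner
        has_derivative_ident bounded_bilinear.FDERIV[OF cross sh[OF \<alpha>] sh[OF \<beta>]]]])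
      (auto simp: inner_add_right)
  moreover have "p \<in> S2" using assms(1) by (simp add: tangent_bundle_def)
  ultimately show "((\<lambda>x. S2_bivector x (\<alpha> x) (\<beta> x)) has_derivative ?D) (at p within S2)"
    by (auto intro: has_derivative_transform[rotated 2] has_derivative_at_withinI simp: S2_bivector_eq)
qed

lemma closed_1form_has_derivative:
  assumes "closed_1form S2 \<alpha>" "p \<in> S2"
  obtains \<alpha>' where "(\<alpha> has_derivative \<alpha>') (at p)"
    "\<And>v w. p \<bullet> v = 0 \<Longrightarrow> p \<bullet> w = 0 \<Longrightarrow> blinfun_apply (\<alpha>' v) w = blinfun_apply (\<alpha>' w) v"
proof -
  obtain U where "S2 \<subseteq> U" "smooth_on_open U \<alpha>" using assms(1) unfolding closed_1form_def by auto
  then have "(\<alpha> has_derivative frechet_derivative \<alpha> (at p)) (at p)"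
    using assms(2) smooth_on_open_has_derivative by blast
  moreover have "blinfun_apply (frechet_derivative \<alpha> (at p) v) w = blinfun_apply (frechet_derivative \<alpha> (at p) w) v"
    if "p \<bullet> v = 0" "p \<bullet> w = 0" for v w
    using assms that unfolding closed_1form_def by (simp add: tangent_space_S2)
  ultimately show ?thesis using that by blast
qed

lemma closed_1form_const: "closed_1form P (\<lambda>_. A)"
proof -
  have "smooth_on_open UNIV (\<lambda>_. A)" by (simp add: smooth_on_open_def Ck_on_const)
  moreover have "frechet_derivative (\<lambda>_. A) (at x) = (\<lambda>_. 0)" for x
    by (rule frechet_derivative_const)
  ultimately show ?thesis unfolding closed_1form_def by auto
qed

text \<open>In the relation for two fibre-linear functions both sides contain \<open>u \<bullet> (\<alpha> \<times> \<beta>)\<close>, and the two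
  remaining terms on each side are matched by closedness.  The other relations can be read off from
  the gradients.\<close>

lemma dual_bivector_at_so3_tangent:
  assumes z: "(u, p) \<in> tangent_bundle S2"
  shows "dual_bivector_at S2 S2_bivector (u, p) (so3_tangent_bivector (u, p))"
  unfolding dual_bivector_at_def
proof (intro conjI allI impI)
  have p: "p \<in> S2" "p \<bullet> p = 1" "p \<bullet> u = 0" using z by (auto simp: tangent_bundle_S2 S2_iff)
  show "bivector_at (tangent_bundle S2) (u, p) (so3_tangent_bivector (u, p))"
    using z by (rule bivector_at_so3_tangent)
  show "bracket (tangent_bundle S2) (\<lambda>_. so3_tangent_bivector (u, p))
      (fibre_linear \<alpha>) (fibre_linear \<beta>) (u, p) =
      fibre_linear (differential S2 (\<lambda>x. S2_bivector x (\<alpha> x) (\<beta> x))) (u, p)"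
    if c\<alpha>: "closed_1form S2 \<alpha>" and c\<beta>: "closed_1form S2 \<beta>" for \<alpha> \<beta>
  proof -
    obtain \<alpha>' where \<alpha>: "(\<alpha> has_derivative \<alpha>') (at p)"
      and cl\<alpha>: "\<And>v w. p \<bullet> v = 0 \<Longrightarrow> p \<bullet> w = 0 \<Longrightarrow> blinfun_apply (\<alpha>' v) w = blinfun_apply (\<alpha>' w) v"
      by (rule closed_1form_has_derivative[OF c\<alpha> p(1)]) (rule that)
    obtain \<beta>' where \<beta>: "(\<beta> has_derivative \<beta>') (at p)"
      and cl\<beta>: "\<And>v w. p \<bullet> v = 0 \<Longrightarrow> p \<bullet> w = 0 \<Longrightarrow> blinfun_apply (\<beta>' v) w = blinfun_apply (\<beta>' w) v"
      by (rule closed_1form_has_derivative[OF c\<beta> p(1)]) (rule that)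
    obtain a where a: "(fibre_linear \<alpha> has_derivative (\<lambda>h. (sharp (\<alpha> p), a) \<bullet> h)) (at (u, p))"
        "\<And>v. a \<bullet> v = blinfun_apply (\<alpha>' v) u"
      using fibre_linear_has_derivative[OF \<alpha>] by metis
    obtain b where b: "(fibre_linear \<beta> has_derivative (\<lambda>h. (sharp (\<beta> p), b) \<bullet> h)) (at (u, p))"
        "\<And>v. b \<bullet> v = blinfun_apply (\<beta>' v) u"
      using fibre_linear_has_derivative[OF \<beta>] by metis
    \<comment> \<open>Closedness turns the derivative of \<open>\<alpha>(u)\<close> along \<open>v\<close> into that of \<open>\<alpha>\<close> along \<open>u\<close>
      evaluated at \<open>v\<close>, which the triple product needs only for tangent \<open>v\<close>.\<close>
    have "p \<bullet> cross3 a (sharp (\<beta> p)) = p \<bullet> cross3 (sharp (\<alpha>' u)) (sharp (\<beta> p))"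
      using p by (intro triple_product_tangential) (auto simp: a(2) cl\<alpha> inner_sharp)
    moreover have "p \<bullet> cross3 b (sharp (\<alpha> p)) = p \<bullet> cross3 (sharp (\<beta>' u)) (sharp (\<alpha> p))"
      using p by (intro triple_product_tangential) (auto simp: b(2) cl\<beta> inner_sharp)
    then have "p \<bullet> cross3 (sharp (\<alpha> p)) b = p \<bullet> cross3 (sharp (\<alpha> p)) (sharp (\<beta>' u))"
      by (metis cross_skew inner_minus_right)
    ultimately show ?thesis
      using bracket_so3_tangent[OF z a(1)[THEN has_derivative_at_withinI] b(1)[THEN has_derivative_at_withinI]]
      by (simp add: fibre_linear_def differential_S2_bivector[OF z \<alpha> \<beta>])
  qed
  show "bracket (tangent_bundle S2) (\<lambda>_. so3_tangent_bivector (u, p)) (fibre_linear \<alpha>) (f \<circ> snd) (u, p) =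
      S2_bivector (snd (u, p)) (\<alpha> (snd (u, p))) (differential S2 f (snd (u, p)))"
    if c\<alpha>: "closed_1form S2 \<alpha>" and f: "smooth_on S2 f" for \<alpha> f
  proof -
    obtain \<alpha>' where \<alpha>: "(\<alpha> has_derivative \<alpha>') (at p)"
      by (rule closed_1form_has_derivative[OF c\<alpha> p(1)]) (rule that)
    obtain a where a: "(fibre_linear \<alpha> has_derivative (\<lambda>h. (sharp (\<alpha> p), a) \<bullet> h)) (at (u, p))"
      using fibre_linear_has_derivative[OF \<alpha>] by metis
    obtain h b where h: "(h has_derivative (\<lambda>v. b \<bullet> v)) (at p)" "\<And>y. y \<in> S2 \<Longrightarrow> h y = f y"
      using smooth_on_has_derivative[OF f p(1)] by metis
    have "(f has_derivative (\<lambda>v. b \<bullet> v)) (at p within S2)"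
      using h(2) by (intro has_derivative_transform[OF p(1) _ has_derivative_at_withinI[OF h(1)]]) simp
    then have "S2_bivector p (\<alpha> p) (differential S2 f p) = p \<bullet> cross3 (sharp (\<alpha> p)) b"
      by (rule S2_bivector_differential[OF p(1)])
    then show ?thesis
      using bracket_so3_tangent[OF z a[THEN has_derivative_at_withinI]
          pullback_snd_has_derivative[OF h z]] by simp
  qed
  show "bracket (tangent_bundle S2) (\<lambda>_. so3_tangent_bivector (u, p)) (f \<circ> snd) (g \<circ> snd) (u, p) = 0"
    if f: "smooth_on S2 f" and g: "smooth_on S2 g" for f g
  proof -
    obtain h a where h: "(h has_derivative (\<lambda>v. a \<bullet> v)) (at p)" "\<And>y. y \<in> S2 \<Longrightarrow> h y = f y"
      using smooth_on_has_derivative[OF f p(1)] by metis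
    obtain k b where k: "(k has_derivative (\<lambda>v. b \<bullet> v)) (at p)" "\<And>y. y \<in> S2 \<Longrightarrow> k y = g y"
      using smooth_on_has_derivative[OF g p(1)] by metis
    show ?thesis
      using bracket_so3_tangent[OF z pullback_snd_has_derivative[OF h z]
          pullback_snd_has_derivative[OF k z]] by simp
  qed
qed

text \<open>The fibre-linear functions of constant forms and the pullbacks of linear functions already have
  differentials that span all covectors of the ambient space, and the relations prescribe their
  brackets; the bracket of a pullback with a fibre-linear function follows by antisymmetry.\<close>

lemma dual_bivector_at_S2_unique:
  assumes z: "(u, p) \<in> tangent_bundle S2"
    and L: "dual_bivector_at S2 S2_bivector (u, p) L"
  shows "L = so3_tangent_bivector (u, p)"
proof (intro ext)
  fix A B
  have p: "p \<in> S2" using z by (auto simp: tangent_bundle_S2 S2_iff)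
  have biv: "bivector_at (tangent_bundle S2) (u, p) L"
    and LL: "\<And>\<alpha> \<beta>. closed_1form S2 \<alpha> \<Longrightarrow> closed_1form S2 \<beta> \<Longrightarrow>
        bracket (tangent_bundle S2) (\<lambda>_. L) (fibre_linear \<alpha>) (fibre_linear \<beta>) (u, p) =
        fibre_linear (differential S2 (\<lambda>x. S2_bivector x (\<alpha> x) (\<beta> x))) (u, p)"
    and LP: "\<And>\<alpha> f. closed_1form S2 \<alpha> \<Longrightarrow> smooth_on S2 f \<Longrightarrow>
        bracket (tangent_bundle S2) (\<lambda>_. L) (fibre_linear \<alpha>) (f \<circ> snd) (u, p) =
        S2_bivector p (\<alpha> p) (differential S2 f p)"
    and PP: "\<And>f g. smooth_on S2 f \<Longrightarrow> smooth_on S2 g \<Longrightarrow>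
        bracket (tangent_bundle S2) (\<lambda>_. L) (f \<circ> snd) (g \<circ> snd) (u, p) = 0"
    using L unfolding dual_bivector_at_def by auto
  have bil: "bilinear L" and alt: "\<And>A. L A A = 0" using biv unfolding bivector_at_def by auto
  note Lbr = bracket_eq[where \<eta> = "\<lambda>_. L", OF biv]
  \<comment> \<open>Covectors along the fibre and along the base.\<close>
  define F P where "F a = blinfun_inner_right (a, 0 :: real^3)"
    and "P a = blinfun_inner_right (0 :: real^3, a)" for a :: "real^3"
  let ?c = "\<lambda>a (_ :: real^3). blinfun_inner_right a"
  have dF: "(fibre_linear (?c a) has_derivative blinfun_apply (F a)) (at (u, p) within T)" for a T
  proof -
    have "fibre_linear (?c a) = blinfun_apply (F a)"
      by (auto simp: fibre_linear_def F_def fun_eq_iff)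
    then show ?thesis by (simp add: bounded_linear_imp_has_derivative blinfun.bounded_linear_right)
  qed
  have dP: "((\<bullet>) a \<circ> snd has_derivative blinfun_apply (P a)) (at (u, p) within T)" for a T
  proof -
    have "(\<bullet>) a \<circ> snd = blinfun_apply (P a)" by (auto simp: P_def fun_eq_iff)
    then show ?thesis by (simp add: bounded_linear_imp_has_derivative blinfun.bounded_linear_right)
  qed
  have smooth: "smooth_on S2 ((\<bullet>) a)" for a
    by (intro smooth_on_bounded_linear bounded_linear_inner_right)
  have FF: "L (F a) (F b) = u \<bullet> cross3 a b" for a b
  proof -
    have "L (F a) (F b) = fibre_linear (differential S2 (\<lambda>x. S2_bivector x (?c a x) (?c b x))) (u, p)"
      using LL[of "?c a" "?c b"] by (simp add: closed_1form_const Lbr[OF dF dF])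
    also have "\<dots> = u \<bullet> cross3 a b"
      using differential_S2_bivector[OF z has_derivative_const has_derivative_const]
      by (simp add: fibre_linear_def linear_0[OF bounded_linear.linear[OF bounded_linear_sharp]])
    finally show ?thesis .
  qed
  have FP: "L (F a) (P b) = p \<bullet> cross3 a b" for a b
  proof -
    have "L (F a) (P b) = S2_bivector p (?c a p) (differential S2 ((\<bullet>) b) p)"
      using LP[of "?c a" "(\<bullet>) b"] by (simp add: closed_1form_const smooth Lbr[OF dF dP])
    also have "\<dots> = p \<bullet> cross3 a b"
      using S2_bivector_differential[OF p bounded_linear_imp_has_derivative[OF bounded_linear_inner_right]]
      by simp
    finally show ?thesis .
  qed
  have PF: "L (P a) (F b) = p \<bullet> cross3 a b" for a b
  proof -
    have "L (P a) (F b) + L (F b) (P a) = 0"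
      using alt[of "F b + P a"] alt[of "F b"] alt[of "P a"]
      by (simp add: bilinear_ladd[OF bil] bilinear_radd[OF bil])
    then show ?thesis by (metis FP add_eq_0_iff2 cross_skew inner_minus_right)
  qed
  have PP': "L (P a) (P b) = 0" for a b
    using PP[OF smooth smooth] by (simp add: Lbr[OF dP dP])
  have split: "C = F (fst (sharp C)) + P (snd (sharp C))" for C
    by (rule blinfun_eqI) (simp add: F_def P_def inner_sharp[of C, symmetric] inner_prod_def blinfun.add_left)
  have "L A B = L (F (fst (sharp A)) + P (snd (sharp A))) (F (fst (sharp B)) + P (snd (sharp B)))"
    using split by metis
  also have "\<dots> = so3_tangent_bivector (u, p) A B"
    by (simp add: bilinear_ladd[OF bil] bilinear_radd[OF bil] FF FP PF PP' so3_tangent_bivector_def)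
  finally show "L A B = so3_tangent_bivector (u, p) A B" .
qed

lemma dual_bivector_S2:
  assumes "(u, p) \<in> tangent_bundle S2"
  shows "dual_bivector S2 S2_bivector (u, p) = so3_tangent_bivector (u, p)"
  unfolding dual_bivector_def
  using dual_bivector_at_so3_tangent[OF assms] dual_bivector_at_S2_unique[OF assms]
  by (rule the_equality)

section \<open>The projection\<close>

definition proj_formula :: "(real^3) \<times> (real^3) \<Rightarrow> real^3"
  where "proj_formula z = sqrt (1 - (fst z \<bullet> fst z) / 4) *\<^sub>R snd z + (1/2) *\<^sub>R fst z"

text \<open>The exponential of a vector of length \<open>arcsin (r/2)\<close> has components \<open>cos (arcsin (r/2))\<close>
  along \<open>p\<close> and \<open>r/2\<close> along the unit vector of \<open>u\<close>, so the arcsine disappears.\<close>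

lemma S2_proj_eq:
  assumes "norm u < 2"
  shows "S2_proj (u, p) = proj_formula (u, p)"
proof (cases "u = 0")
  case True
  then show ?thesis by (simp add: S2_proj_zero_section proj_formula_def)
next
  case False
  define r where "r = norm u"
  define \<theta> where "\<theta> = arcsin (r / 2)"
  have r: "0 < r" "r < 2" using False assms by (auto simp: r_def)
  have sin: "sin \<theta> = r / 2" using r by (simp add: \<theta>_def)
  have "\<theta> > 0" using r arcsin_less_arcsin[of 0 "r/2"] by (simp add: \<theta>_def)
  then have len: "norm ((1 / r * \<theta>) *\<^sub>R u) = \<theta>" using r by (simp add: r_def)
  have "cos \<theta> = sqrt (1 - (u \<bullet> u) / 4)"
    using r by (simp add: \<theta>_def cos_arcsin power_divide) (simp add: r_def power2_norm_eq_inner)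
  then show ?thesis
    unfolding S2_proj_def S2_exp_def prod.case r_def[symmetric] \<theta>_def[symmetric] len sin
    using r \<open>\<theta> > 0\<close> by (simp add: proj_formula_def)
qed

lemma radicand_pos: "norm u < 2 \<Longrightarrow> 0 < 1 - (u \<bullet> u) / 4" for u :: "'a::real_inner"
  using power_strict_mono[of "norm u" 2 2] by (simp add: power2_norm_eq_inner)

lemma smooth_proj_formula: "smooth_on_open {z. norm (fst z) < 2} proj_formula"
proof -
  let ?U = "{z :: (real^3) \<times> (real^3). norm (fst z) < 2}"
  have U: "open ?U" by (intro open_Collect_less continuous_intros)
  have "Ck_on k proj_formula ?U" for k
  proof -
    have fst: "Ck_on k fst ?U" and snd: "Ck_on k snd ?U"
      by (intro Ck_on_bounded_linear U bounded_linear_fst bounded_linear_snd)+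
    have "Ck_on k (\<lambda>z. 1 + (- 1/4) * (fst z \<bullet> fst z)) ?U"
      by (intro Ck_on_add Ck_on_const U Ck_on_bounded_bilinear[OF U bounded_bilinear_mult]
          Ck_on_bounded_bilinear[OF U bounded_bilinear_inner] fst)
    then have "Ck_on k (\<lambda>z. (1 + (- 1/4) * (fst z \<bullet> fst z)) powr (1/2)) ?U"
      by (intro Ck_on_powr U) (auto dest: radicand_pos)
    then have "Ck_on k (\<lambda>z. (1 + (- 1/4) * (fst z \<bullet> fst z)) powr (1/2) *\<^sub>R snd z + (1/2) *\<^sub>R fst z) ?U"
      by (intro Ck_on_add U Ck_on_bounded_bilinear[OF U bounded_bilinear_scaleR] snd fst Ck_on_const)
    then show ?thesis
      by (rule Ck_on_cong[OF U, THEN iffD1, rotated])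
        (use radicand_pos in \<open>fastforce simp: proj_formula_def powr_half_sqrt\<close>)
  qed
  then show ?thesis unfolding smooth_on_open_def using U by blast
qed

lemma pullback_proj_has_derivative:
  assumes "norm u < 2"
    and "(h has_derivative (\<lambda>v. a \<bullet> v)) (at (proj_formula (u, p)))"
    and "s = sqrt (1 - (u \<bullet> u) / 4)"
  shows "(h \<circ> proj_formula has_derivative
    (\<lambda>v. ((1/2) *\<^sub>R a - ((a \<bullet> p) / (4 * s)) *\<^sub>R u, s *\<^sub>R a) \<bullet> v)) (at (u, p))"
proof -
  have pos: "0 < 1 - (u \<bullet> u) / 4" using assms(1) by (rule radicand_pos)
  define S where "S z = sqrt (1 - (fst z \<bullet> fst z) / 4)" for z :: "(real^3) \<times> (real^3)"
  have S: "(S has_derivative (\<lambda>v. - ((u \<bullet> fst v) / (4 * s)))) (at (u, p))"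
    using pos unfolding assms(3) S_def
    by (auto intro!: derivative_eq_intros simp: fun_eq_iff inner_commute field_simps)
  have formula: "proj_formula = (\<lambda>z. S z *\<^sub>R snd z + (1/2) *\<^sub>R fst z)" and "S (u, p) = s"
    by (simp_all add: fun_eq_iff proj_formula_def S_def assms(3))
  then have "(proj_formula has_derivative
      (\<lambda>v. s *\<^sub>R snd v + (- ((u \<bullet> fst v) / (4 * s))) *\<^sub>R p + (1/2) *\<^sub>R fst v)) (at (u, p))"
    unfolding formula by (auto intro!: derivative_eq_intros S)
  then have "(h \<circ> proj_formula has_derivative
      (\<lambda>v. a \<bullet> (s *\<^sub>R snd v + (- ((u \<bullet> fst v) / (4 * s))) *\<^sub>R p + (1/2) *\<^sub>R fst v))) (at (u, p))"
    unfolding comp_def using assms(2) by (rule has_derivative_compose)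
  then show ?thesis
    by (rule has_derivative_eq_rhs)
      (simp add: fun_eq_iff inner_prod_def inner_add_right inner_diff_left algebra_simps)
qed

text \<open>Four vectors \<open>p\<close>, \<open>u\<close>, \<open>a\<close>, \<open>b\<close> of a three-dimensional space satisfy a linear relation
  whose coefficients are their triple products; this is its inner product with \<open>p\<close>.\<close>

lemma triple_product_exchange:
  "(p \<bullet> p) * (u \<bullet> cross3 a b) =
    (p \<bullet> u) * (p \<bullet> cross3 a b) + (a \<bullet> p) * (u \<bullet> cross3 p b) + (b \<bullet> p) * (u \<bullet> cross3 a p)"
  by (simp add: cross3_simps)

theorem proposition6p2:
  shows "poisson_map {(u, p) \<in> tangent_bundle S2. norm u < 2} (dual_bivector S2 S2_bivector)
           S2 S2_bivector S2_proj"
  unfolding poisson_map_def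
proof (intro conjI allI impI ballI)
  let ?M = "{(u, p) \<in> tangent_bundle S2. norm u < 2}"
  have proj: "S2_proj z = proj_formula z" if "z \<in> ?M" for z
    using that S2_proj_eq by auto
  show img: "S2_proj ` ?M \<subseteq> S2"
  proof (intro subsetI, elim imageE)
    fix x z assume x: "x = S2_proj z" and z: "z \<in> ?M"
    then obtain u p where up: "z = (u, p)" "p \<bullet> p = 1" "p \<bullet> u = 0" "norm u < 2"
      by (auto simp: tangent_bundle_S2)
    then show "x \<in> S2"
      using radicand_pos[OF up(4)] unfolding x proj[OF z] S2_iff proj_formula_def
      by (simp add: inner_add_left inner_add_right inner_commute)
  qed
  show "smooth_on ?M S2_proj"
    unfolding smooth_on_def
    by (rule exI[of _ "{z. norm (fst z) < 2}"], rule exI[of _ proj_formula])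
      (use smooth_proj_formula proj in auto)
  fix f g :: "real^3 \<Rightarrow> real" and z
  assume f: "smooth_on S2 f" and g: "smooth_on S2 g" and zM: "z \<in> ?M"
  obtain u p where z: "z = (u, p)" by fastforce
  then have TS: "(u, p) \<in> tangent_bundle S2" and u: "norm u < 2" using zM by auto
  then have p: "p \<bullet> p = 1" "p \<bullet> u = 0" by (auto simp: tangent_bundle_S2)
  define s where "s = sqrt (1 - (u \<bullet> u) / 4)"
  have s: "s > 0" using radicand_pos[OF u] by (simp add: s_def)
  define q where "q = proj_formula (u, p)"
  have "S2_proj z = q" using proj[OF zM] by (simp add: q_def z)
  moreover from this have "q \<in> S2" using img zM by blast
  moreover have "q = s *\<^sub>R p + (1/2) *\<^sub>R u" by (simp add: q_def s_def proj_formula_def)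
  ultimately have q: "q \<in> S2" "q = s *\<^sub>R p + (1/2) *\<^sub>R u" "S2_proj z = q" by blast+
  \<comment> \<open>The domain is open in the tangent bundle, so the two carry the same differentials.\<close>
  have at: "at z within ?M = at z within tangent_bundle S2"
    by (rule at_within_nhd[of _ "{z. norm (fst z) < 2}"])
      (use u in \<open>auto simp: z intro!: open_Collect_less continuous_intros\<close>)
  have pull: "(f \<circ> S2_proj has_derivative
      (\<lambda>v. ((1/2) *\<^sub>R a - ((a \<bullet> p) / (4 * s)) *\<^sub>R u, s *\<^sub>R a) \<bullet> v)) (at (u, p) within tangent_bundle S2)"
    if h: "(h has_derivative (\<lambda>v. a \<bullet> v)) (at q)" "\<And>y. y \<in> S2 \<Longrightarrow> h y = f y"
    for f h :: "real^3 \<Rightarrow> real" and a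
    unfolding at[unfolded z, symmetric]
  proof (rule has_derivative_transform)
    show "(u, p) \<in> ?M" using zM z by simp
    show "(f \<circ> S2_proj) y = (h \<circ> proj_formula) y" if "y \<in> ?M" for y
    proof -
      have "S2_proj y \<in> S2" using img that by blast
      then show ?thesis using h(2) by (simp flip: proj[OF that])
    qed
    show "(h \<circ> proj_formula has_derivative
        (\<lambda>v. ((1/2) *\<^sub>R a - ((a \<bullet> p) / (4 * s)) *\<^sub>R u, s *\<^sub>R a) \<bullet> v)) (at (u, p) within ?M)"
      by (rule has_derivative_at_withinI[OF pullback_proj_has_derivative[OF u h(1)[unfolded q_def] s_def]])
  qed
  obtain h a where h: "(h has_derivative (\<lambda>v. a \<bullet> v)) (at q)" "\<And>y. y \<in> S2 \<Longrightarrow> h y = f y"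
    using smooth_on_has_derivative[OF f q(1)] by metis
  obtain k b where k: "(k has_derivative (\<lambda>v. b \<bullet> v)) (at q)" "\<And>y. y \<in> S2 \<Longrightarrow> k y = g y"
    using smooth_on_has_derivative[OF g q(1)] by metis
  have "bracket ?M (dual_bivector S2 S2_bivector) (f \<circ> S2_proj) (g \<circ> S2_proj) z
      = bracket (tangent_bundle S2) (\<lambda>_. so3_tangent_bivector (u, p)) (f \<circ> S2_proj) (g \<circ> S2_proj) (u, p)"
    unfolding bracket_def differential_def at unfolding z dual_bivector_S2[OF TS] ..
  also have "\<dots> = u \<bullet> cross3 ((1/2) *\<^sub>R a - ((a \<bullet> p) / (4 * s)) *\<^sub>R u) ((1/2) *\<^sub>R b - ((b \<bullet> p) / (4 * s)) *\<^sub>R u)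
      + p \<bullet> cross3 ((1/2) *\<^sub>R a - ((a \<bullet> p) / (4 * s)) *\<^sub>R u) (s *\<^sub>R b)
      + p \<bullet> cross3 (s *\<^sub>R a) ((1/2) *\<^sub>R b - ((b \<bullet> p) / (4 * s)) *\<^sub>R u)"
    by (rule bracket_so3_tangent[OF TS pull[OF h] pull[OF k]])
  also have "\<dots> = (u \<bullet> cross3 a b) / 4 + s * (p \<bullet> cross3 a b)
      - ((a \<bullet> p) * (p \<bullet> cross3 u b) + (b \<bullet> p) * (p \<bullet> cross3 a u)) / 4"
    using s
    by (simp add: Cross3.left_diff_distrib Cross3.right_diff_distrib cross_mult_left cross_mult_right
        inner_diff_right inner_add_right dot_cross_self field_simps)
  also have "\<dots> = s * (p \<bullet> cross3 a b) + (u \<bullet> cross3 a b) / 2"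
  proof -
    have "p \<bullet> cross3 u b = - (u \<bullet> cross3 p b)" "p \<bullet> cross3 a u = - (u \<bullet> cross3 a p)"
      by (simp_all add: cross3_simps)
    then show ?thesis using triple_product_exchange[of p u a b] p by (simp add: field_simps)
  qed
  also have "\<dots> = q \<bullet> cross3 a b"
    by (simp add: q(2) inner_add_left)
  also have "\<dots> = bracket S2 S2_bivector f g q"
    by (rule bracket_S2[symmetric, OF q(1)
          has_derivative_transform[OF q(1) h(2)[symmetric] has_derivative_at_withinI[OF h(1)]]
          has_derivative_transform[OF q(1) k(2)[symmetric] has_derivative_at_withinI[OF k(1)]]])
  finally show "bracket ?M (dual_bivector S2 S2_bivector) (f \<circ> S2_proj) (g \<circ> S2_proj) z =
      bracket S2 S2_bivector f g (S2_proj z)"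
    by (simp only: q(3))
qed

end
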